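(* Let $a>0$, $\lambda\ge0$, and $C>0$. Consider one of the following cases. Finite endpoint: there are $B>0$, $b\ge0$, an integer $N\ge1$, and $0<\zeta_1<\cdots<\zeta_N<B$ such that $$\Phi(u)=C\,u^{a/2}(B-u)^{b/2}e^{-\lambda u/2}\prod_{j=1}^N\left(1-\frac u{\zeta_j}\right),\qquad 0<u<B.$$ Infinite endpoint: on $(0,\infty)$, $$\Phi(u)=C\,u^{a/2}e^{-\lambda u/2}\prod_{j\in\mathcal J}\left(1-\frac u{\zeta_j}\right),$$ where $\mathcal J$ is finite or countable; for a nonempty product, $0<\zeta_1<\zeta_2<\cdots$, and in the countably infinite case $\sum_j\zeta_j^{-1}<\infty$. The empty product is allowed if $\lambda>0$. If the product is empty put $\zeta_1=\infty$, and in either case set $\Phi(0)=0$ by continuous extension. Then $\Phi$ attains its maximum on $(0,\zeta_1)$ at a unique point $u_1$; write $A=\Phi(u_1)$. Moreover $$\frac{\Phi(tu_1)}A\ge t^{a/2}\left(1+\frac a2(1-t)\right),\qquad 0\le t\le1+\frac2a.$$ Consequently, $$\int_0^{u_1}\frac{\Phi(u)^2}u\,du\ge\frac{A^2}aR(a),\qquad R(a)=1+\frac a{a+1}+\frac{a^2}{2(a+1)(a+2)}=\frac{5a^2+10a+4}{2(a+1)(a+2)}.$$ Define also $$R_*(a):=a\int_0^{1+2/a}t^{a-1}\left(1+\frac a2(1-t)\right)^2dt=\frac{a+2}{2(a+1)}\left(\frac{a+2}a\right)^a$$ (the last equality being part of the assertion). Then $R_*(a)>R(a)$. Put $L=B$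 in the finite-endpoint case and $L=\infty$ in the infinite-endpoint case. If the full inverse moment $$I:=\int_0^L\frac{\Phi(u)^2}u\,du$$ is finite, then $$A^2<\frac{aI}{R_*(a)}.$$ *)

theory Defs
  imports "HOL-Analysis.Analysis"
begin

text \<open>
  The zeros are indexed from 1. The arguments \<open>z\<close> and \<open>L\<close> of the two predicates below are the
  first zero (\<open>\<infinity>\<close> for the empty product) and the right endpoint of the domain of \<open>\<Phi>\<close>.
  Outside the open interval from 0 to \<open>L\<close> the function \<open>\<Phi>\<close> is left unconstrained.
\<close>

definition finite_endpoint ::
  "real \<Rightarrow> real \<Rightarrow> real \<Rightarrow> (real \<Rightarrow> real) \<Rightarrow> ereal \<Rightarrow> ereal \<Rightarrow> bool" where
  "finite_endpoint a lam C \<Phi> z L \<longleftrightarrow>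
    (\<exists>(B::real) (b::real) (N::nat) (\<zeta> :: nat \<Rightarrow> real).
      B > 0 \<and> b \<ge> 0 \<and> N \<ge> 1 \<and>
      strict_mono_on {1..N} \<zeta> \<and> (\<forall>j\<in>{1..N}. 0 < \<zeta> j \<and> \<zeta> j < B) \<and>
      (\<forall>u. 0 < u \<and> u < B \<longrightarrow>
        \<Phi> u = C * u powr (a/2) * (B - u) powr (b/2) * exp (- lam * u / 2)
               * (\<Prod>j=1..N. 1 - u / \<zeta> j)) \<and>
      z = ereal (\<zeta> 1) \<and> L = ereal B)"

definition infinite_endpoint ::
  "real \<Rightarrow> real \<Rightarrow> real \<Rightarrow> (real \<Rightarrow> real) \<Rightarrow> ereal \<Rightarrow> ereal \<Rightarrow> bool" where
  "infinite_endpoint a lam C \<Phi> z L \<longleftrightarrow>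
    L = \<infinity> \<and>
    ((\<exists>(N::nat) (\<zeta> :: nat \<Rightarrow> real).
        (N = 0 \<longrightarrow> lam > 0) \<and>
        strict_mono_on {1..N} \<zeta> \<and> (\<forall>j\<in>{1..N}. 0 < \<zeta> j) \<and>
        (\<forall>u>0. \<Phi> u = C * u powr (a/2) * exp (- lam * u / 2) * (\<Prod>j=1..N. 1 - u / \<zeta> j)) \<and>
        z = (if N = 0 then \<infinity> else ereal (\<zeta> 1)))
     \<or>
     (\<exists>\<zeta> :: nat \<Rightarrow> real.
        strict_mono_on {1..} \<zeta> \<and> (\<forall>j\<ge>1. 0 < \<zeta> j) \<and>
        summable (\<lambda>j. 1 / \<zeta> (Suc j)) \<and>
        (\<forall>u>0. \<Phi> u = C * u powr (a/2) * exp (- lam * u / 2) * (\<Prod>j. 1 - u / \<zeta> (Suc j))) \<and>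
        z = ereal (\<zeta> 1)))"

definition R :: "real \<Rightarrow> real" where
  "R a = 1 + a / (a + 1) + a\<^sup>2 / (2 * (a + 1) * (a + 2))"

definition R_star :: "real \<Rightarrow> real" where
  "R_star a = a * (LBINT t=0..ereal (1 + 2/a). t powr (a - 1) * (1 + a/2 * (1 - t))\<^sup>2)"

definition inverse_moment :: "(real \<Rightarrow> real) \<Rightarrow> ereal \<Rightarrow> ennreal" where
  "inverse_moment \<Phi> L = (\<integral>\<^sup>+u\<in>einterval 0 L. ennreal ((\<Phi> u)\<^sup>2 / u) \<partial>lborel)"

end

theory Submission
  imports Defs "HOL-Real_Asymp.Real_Asymp"
begin

text \<open>
  Write \<open>\<Phi> u = u powr (a/2) * g u\<close>. Up to its first zero \<open>z\<close> the function \<open>g\<close> is positive, decreasing,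
  log-concave and also convex. Log-concavity makes the maximizer \<open>w\<close> unique. Maximality forces the
  supporting line of the convex \<open>g\<close> at \<open>w\<close> to have slope \<open>- (a/2) * g w / w\<close>, which is the lower bound
  \<open>\<Phi> (t * w) / \<Phi> w \<ge> t powr (a/2) * (1 + a/2 * (1 - t))\<close>; evaluated at \<open>z\<close> the same line gives
  \<open>(1 + 2/a) * w \<le> z\<close>. Squaring and integrating yields both integral estimates, and the last one is
  strict because \<open>\<Phi>\<close> vanishes almost nowhere beyond \<open>(1 + 2/a) * w\<close>.
\<close>

subsection \<open>The minorant and its inverse moment\<close>

definition minorant :: "real \<Rightarrow> real \<Rightarrow> real" where
  "minorant a t = t powr (a/2) * (1 + a/2 * (1 - t))"

definition minorant_moment :: "real \<Rightarrow> real \<Rightarrow> real" where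
  "minorant_moment a t = t powr a *
     ((a + 2)\<^sup>2 / (4 * a) - a * (a + 2) / (2 * (a + 1)) * t + a\<^sup>2 / (4 * (a + 2)) * t\<^sup>2)"

lemma minorant_nonneg:
  assumes "0 < a" "t \<le> 1 + 2/a"
  shows "0 \<le> minorant a t"
proof -
  have "0 \<le> 1 + a/2 * (1 - t)" using assms by (simp add: field_simps)
  then show ?thesis by (simp add: minorant_def)
qed

lemma minorant_square_divide:
  assumes "0 < t"
  shows "(minorant a t)\<^sup>2 / t = t powr (a - 1) * (1 + a/2 * (1 - t))\<^sup>2"
  using assms by (simp add: minorant_def power_mult_distrib powr_power powr_diff)

lemma minorant_moment_has_real_derivative:
  assumes "0 < a" "0 < t"
  shows "(minorant_moment a has_real_derivative (minorant a t)\<^sup>2 / t) (at t)"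
proof -
  define \<alpha> \<beta> \<gamma> where "\<alpha> = (a + 2)\<^sup>2 / (4 * a)" and "\<beta> = a * (a + 2) / (2 * (a + 1))"
    and "\<gamma> = a\<^sup>2 / (4 * (a + 2))"
  have coeffs: "a * \<alpha> = (1 + a/2)\<^sup>2" "(a + 1) * \<beta> = a * (1 + a/2)" "(a + 2) * \<gamma> = (a/2)\<^sup>2"
    using assms by (simp_all add: \<alpha>_def \<beta>_def \<gamma>_def field_simps power2_eq_square)
  have "a * (\<alpha> - \<beta> * t + \<gamma> * t\<^sup>2) + t * (- \<beta> + \<gamma> * (2 * t))
      = a * \<alpha> - (a + 1) * \<beta> * t + (a + 2) * \<gamma> * t\<^sup>2"
    by algebra
  also have "\<dots> = (1 + a/2 * (1 - t))\<^sup>2"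
    unfolding coeffs by (simp add: power2_eq_square field_simps)
  finally have square: "a * (\<alpha> - \<beta> * t + \<gamma> * t\<^sup>2) + t * (- \<beta> + \<gamma> * (2 * t)) = (1 + a/2 * (1 - t))\<^sup>2" .
  have "((\<lambda>t. t powr a * (\<alpha> - \<beta> * t + \<gamma> * t\<^sup>2)) has_real_derivative
      a * t powr (a - 1) * (\<alpha> - \<beta> * t + \<gamma> * t\<^sup>2) + (- \<beta> + \<gamma> * (2 * t)) * t powr a) (at t)"
    by (rule DERIV_mult[OF has_real_derivative_powr[OF assms(2)]]) (auto intro!: derivative_eq_intros)
  also have "t powr a = t powr (a - 1) * t"
    using assms by (simp add: powr_diff)
  also have "a * t powr (a - 1) * (\<alpha> - \<beta> * t + \<gamma> * t\<^sup>2) + (- \<beta> + \<gamma> * (2 * t)) * (t powr (a - 1) * t)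
      = (minorant a t)\<^sup>2 / t"
    unfolding minorant_square_divide[OF assms(2)] square[symmetric] by (simp add: algebra_simps)
  finally show ?thesis
    by (simp add: minorant_moment_def[abs_def] \<alpha>_def \<beta>_def \<gamma>_def)
qed

lemma continuous_on_minorant_moment:
  assumes "0 < a"
  shows "continuous_on {0..} (minorant_moment a)"
  unfolding minorant_moment_def using assms by (intro continuous_intros continuous_on_powr') auto

lemma minorant_moment_1:
  assumes "0 < a"
  shows "a * minorant_moment a 1 = R a"
proof -
  define p q where "p = a + 1" and "q = a + 2"
  have pq: "p > 0" "q > 0" using assms by (auto simp: p_def q_def)
  have "a * minorant_moment a 1 = q\<^sup>2 / 4 - a\<^sup>2 * q / (2 * p) + a * a\<^sup>2 / (4 * q)"
    unfolding minorant_moment_def p_def[symmetric] q_def[symmetric]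
    using assms by (simp add: distrib_left right_diff_distrib power2_eq_square)
  also have "\<dots> = 1 + a / p + a\<^sup>2 / (2 * p * q)"
    using pq by (simp add: divide_simps power2_eq_square) (simp add: p_def q_def, algebra)
  finally show ?thesis by (simp add: R_def p_def q_def)
qed

lemma minorant_moment_endpoint:
  assumes "0 < a"
  shows "a * minorant_moment a (1 + 2/a) = (a + 2) / (2 * (a + 1)) * ((a + 2) / a) powr a"
proof -
  define p q where "p = a + 1" and "q = a + 2"
  have pq: "p > 0" "q > 0" using assms by (auto simp: p_def q_def)
  have q: "1 + 2/a = q / a" using assms by (simp add: q_def field_simps)
  have "q\<^sup>2 / 4 - a * q\<^sup>2 / (2 * p) + a * q / 4 = q / (2 * p)"
    using pq by (simp add: divide_simps power2_eq_square) (simp add: p_def q_def, algebra)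
  moreover have "a * (q\<^sup>2 / (4 * a) - a * q / (2 * p) * (q / a) + a\<^sup>2 / (4 * q) * (q / a)\<^sup>2)
      = q\<^sup>2 / 4 - a * q\<^sup>2 / (2 * p) + a * q / 4"
    using assms pq by (simp add: field_simps power2_eq_square)
  ultimately have "a * (q\<^sup>2 / (4 * a) - a * q / (2 * p) * (q / a) + a\<^sup>2 / (4 * q) * (q / a)\<^sup>2) = q / (2 * p)"
    by (rule trans[rotated])
  then show ?thesis
    unfolding q minorant_moment_def p_def[symmetric] q_def[symmetric] mult.left_commute[of a] by simp
qed

lemma minorant_integral:
  assumes "0 < a" "0 < w" "0 < p"
  shows "set_integrable lborel {0<..<p} (\<lambda>u. (minorant a (u / w))\<^sup>2 / u)"
    and "(LBINT u:{0<..<p}. (minorant a (u / w))\<^sup>2 / u) = minorant_moment a (p / w)"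
proof -
  define F where "F u = minorant_moment a (u / w)" for u
  have deriv: "(F has_real_derivative (minorant a (u / w))\<^sup>2 / u) (at u)" if "0 < u" for u
  proof -
    have "(F has_real_derivative (minorant a (u / w))\<^sup>2 / (u / w) * (1 / w)) (at u)"
      unfolding F_def using that assms
      by (intro DERIV_chain2[OF minorant_moment_has_real_derivative DERIV_cdivide[OF DERIV_ident]]) auto
    then show ?thesis using assms by simp
  qed
  have cont: "isCont (\<lambda>u. (minorant a (u / w))\<^sup>2 / u) u" if "0 < u" for u
    unfolding minorant_def using that assms by (intro continuous_intros) auto
  have "continuous_on {0..} F"
    unfolding F_def using assms
    by (intro continuous_on_compose2[OF continuous_on_minorant_moment]) (auto intro!: continuous_intros)
  then have "(F \<longlongrightarrow> F 0) (at 0 within {0..})"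
    unfolding continuous_on_def by simp
  then have lim_0: "(F \<longlongrightarrow> 0) (at_right 0)"
    by (auto simp: F_def minorant_moment_def intro: tendsto_within_subset)
  have lim_p: "(F \<longlongrightarrow> F p) (at_left p)"
    using DERIV_isCont[OF deriv[OF assms(3)]] by (simp add: isCont_def filterlim_at_split)
  have lims: "((F \<circ> real_of_ereal) \<longlongrightarrow> 0) (at_right (ereal 0))"
       "((F \<circ> real_of_ereal) \<longlongrightarrow> F p) (at_left (ereal p))"
    using lim_0 lim_p by (simp_all only: ereal_tendsto_simps)
  note FTC = interval_integral_FTC_nonneg[of "ereal 0" "ereal p" F "\<lambda>u. (minorant a (u / w))\<^sup>2 / u",
      OF _ _ _ _ lims]
  show "set_integrable lborel {0<..<p} (\<lambda>u. (minorant a (u / w))\<^sup>2 / u)"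
    using FTC(1) deriv cont assms by simp
  have "(LBINT u=ereal 0..ereal p. (minorant a (u / w))\<^sup>2 / u) = F p"
    using FTC(2) deriv cont assms by simp
  then show "(LBINT u:{0<..<p}. (minorant a (u / w))\<^sup>2 / u) = minorant_moment a (p / w)"
    using assms by (simp add: interval_lebesgue_integral_def F_def)
qed

lemma minorant_nn_integral:
  assumes "0 < a" "0 < w" "0 < p" "0 \<le> k"
  shows "(\<integral>\<^sup>+u\<in>{0<..<p}. ennreal (k * ((minorant a (u / w))\<^sup>2 / u)) \<partial>lborel)
    = ennreal (k * minorant_moment a (p / w))"
proof -
  let ?f = "\<lambda>u. k * ((minorant a (u / w))\<^sup>2 / u)"
  have int: "set_integrable lborel {0<..<p} ?f"
    by (intro set_integrable_mult_right minorant_integral assms)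
  have "(\<integral>\<^sup>+u\<in>{0<..<p}. ennreal (?f u) \<partial>lborel) = (\<integral>\<^sup>+u. ennreal (indicator {0<..<p} u *\<^sub>R ?f u) \<partial>lborel)"
    by (intro nn_integral_cong) (auto simp: indicator_def)
  also have "\<dots> = ennreal (LBINT u:{0<..<p}. ?f u)"
    using int assms(4) unfolding set_lebesgue_integral_def set_integrable_def
    by (intro nn_integral_eq_integral) (auto simp: indicator_def)
  also have "(LBINT u:{0<..<p}. ?f u) = k * minorant_moment a (p / w)"
    by (simp only: set_integral_mult_right minorant_integral(2)[OF assms(1-3)])
  finally show ?thesis .
qed

lemma R_eq:
  assumes "0 < a"
  shows "R a = (5 * a\<^sup>2 + 10 * a + 4) / (2 * (a + 1) * (a + 2))"
proof -
  define p q where "p = a + 1" and "q = a + 2"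
  have "p > 0" "q > 0" using assms by (auto simp: p_def q_def)
  then have "1 + a / p + a\<^sup>2 / (2 * p * q) = (2 * p * q + 2 * a * q + a\<^sup>2) / (2 * p * q)"
    by (simp add: add_divide_distrib)
  also have "2 * p * q + 2 * a * q + a\<^sup>2 = 5 * a\<^sup>2 + 10 * a + 4"
    unfolding p_def q_def by algebra
  finally show ?thesis by (simp add: R_def p_def q_def)
qed

lemma R_star_eq_minorant_moment:
  assumes "0 < a"
  shows "R_star a = a * minorant_moment a (1 + 2/a)"
proof -
  have pos: "0 < 1 + 2/a" using assms by (simp add: add_pos_pos)
  have "(LBINT t=0..ereal (1 + 2/a). t powr (a - 1) * (1 + a/2 * (1 - t))\<^sup>2)
      = (LBINT t:{0<..<1 + 2/a}. t powr (a - 1) * (1 + a/2 * (1 - t))\<^sup>2)"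
    using pos by (simp add: interval_lebesgue_integral_def zero_ereal_def)
  also have "\<dots> = (LBINT t:{0<..<1 + 2/a}. (minorant a (t / 1))\<^sup>2 / t)"
    by (intro set_lebesgue_integral_cong) (auto simp: minorant_square_divide)
  also have "\<dots> = minorant_moment a (1 + 2/a)"
    using minorant_integral(2)[OF assms zero_less_one pos] by simp
  finally show ?thesis by (simp add: R_star_def)
qed

lemma R_star_eq:
  assumes "0 < a"
  shows "R_star a = (a + 2) / (2 * (a + 1)) * ((a + 2) / a) powr a"
  using R_star_eq_minorant_moment minorant_moment_endpoint assms by simp

lemma R_star_pos:
  assumes "0 < a"
  shows "0 < R_star a"
  unfolding R_star_eq[OF assms] using assms by (intro mult_pos_pos divide_pos_pos) auto

lemma R_less_R_star:
  assumes "0 < a"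
  shows "R a < R_star a"
proof -
  have "minorant_moment a 1 < minorant_moment a (1 + 2/a)"
  proof (rule DERIV_pos_imp_increasing_open[where f = "minorant_moment a"])
    fix t :: real assume t: "1 < t" "t < 1 + 2/a"
    then have "0 < 1 + a/2 * (1 - t)" using assms by (simp add: field_simps)
    then have "0 < (minorant a t)\<^sup>2 / t" using t by (simp add: minorant_def)
    then show "\<exists>y. (minorant_moment a has_real_derivative y) (at t) \<and> 0 < y"
      using minorant_moment_has_real_derivative[OF assms] t by (intro exI conjI) auto
  next
    show "continuous_on {1..1 + 2/a} (minorant_moment a)"
      by (rule continuous_on_subset[OF continuous_on_minorant_moment[OF assms]]) auto
  qed (use assms in simp)
  then show ?thesis
    using assms by (simp add: R_star_eq_minorant_moment flip: minorant_moment_1)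
qed

subsection \<open>Maxima of a power times a convex, log-concave function\<close>

lemma is_interval_einterval: "is_interval (einterval l r)"
proof -
  have "y \<in> einterval l r" if "x \<in> einterval l r" "z \<in> einterval l r" "x \<le> y" "y \<le> z" for x y z
  proof -
    have "l < ereal x" "ereal x \<le> ereal y" "ereal y \<le> ereal z" "ereal z < r"
      using that by (simp_all add: einterval_iff)
    then show ?thesis unfolding einterval_iff by (blast intro: less_le_trans le_less_trans)
  qed
  then show ?thesis unfolding is_interval_1 by blast
qed

lemma continuous_on_einterval_attains_max:
  fixes f :: "real \<Rightarrow> real"
  assumes cont: "continuous_on (einterval l r) f" and v: "v \<in> einterval l r"
    and left: "\<forall>\<^sub>F u in at_right l. f (real_of_ereal u) < f v"
    and right: "\<forall>\<^sub>F u in at_left r. f (real_of_ereal u) < f v"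
  shows "\<exists>w. is_arg_max f (\<lambda>u. u \<in> einterval l r) w"
proof -
  have lr: "l < ereal v" "ereal v < r" using v by (auto simp: einterval_iff)
  obtain b where b: "l < b" "\<And>x. l < x \<Longrightarrow> x < b \<Longrightarrow> f (real_of_ereal x) < f v"
    using left unfolding eventually_at_right[OF lr(1)] by auto
  obtain d where d: "d < r" "\<And>x. d < x \<Longrightarrow> x < r \<Longrightarrow> f (real_of_ereal x) < f v"
    using right unfolding eventually_at_left[OF lr(2)] by auto
  obtain p where p: "l < ereal p" "ereal p < min (ereal v) b"
    using ereal_dense2[of l "min (ereal v) b"] lr b by auto
  obtain q where q: "max (ereal v) d < ereal q" "ereal q < r"
    using ereal_dense2[of "max (ereal v) d" r] lr d by auto
  have pvq: "p < v" "v < q" using p q by auto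
  have "ereal p < r" "l < ereal q"
    using less_trans[of "ereal p" "ereal v" r] less_trans[of l "ereal v" "ereal q"] lr pvq by simp_all
  then have "p \<in> einterval l r" "q \<in> einterval l r" using p q by (simp_all add: einterval_iff)
  then have sub: "{p..q} \<subseteq> einterval l r"
    using interval_subset_is_interval[OF is_interval_einterval, of p q] by simp
  obtain w where w: "w \<in> {p..q}" "\<And>u. u \<in> {p..q} \<Longrightarrow> f u \<le> f w"
    using continuous_attains_sup[OF compact_Icc _ continuous_on_subset[OF cont sub]] pvq by auto
  have "f u \<le> f w" if u: "u \<in> einterval l r" for u
  proof (cases "u \<in> {p..q}")
    case False
    then have "ereal u < ereal p \<or> ereal q < ereal u" by auto
    then have "ereal u < b \<or> d < ereal u"
      using p(2) q(1) unfolding min_less_iff_conj max_less_iff_conj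
      by (blast intro: less_trans)
    then have "f u < f v" using b(2)[of "ereal u"] d(2)[of "ereal u"] u by (auto simp: einterval_iff)
    also have "f v \<le> f w" using w(2)[of v] pvq by simp
    finally show ?thesis by simp
  qed (rule w(2))
  moreover have "w \<in> einterval l r" using w(1) sub by blast
  ultimately show ?thesis by (auto simp: is_arg_max_linorder)
qed

definition midpoint_log_concave_on :: "real set \<Rightarrow> (real \<Rightarrow> real) \<Rightarrow> bool" where
  "midpoint_log_concave_on S f \<longleftrightarrow> (\<forall>x\<in>S. \<forall>y\<in>S. f x * f y \<le> (f ((x + y) / 2))\<^sup>2)"

lemma midpoint_log_concave_onI:
  "(\<And>x y. x \<in> S \<Longrightarrow> y \<in> S \<Longrightarrow> f x * f y \<le> (f ((x + y) / 2))\<^sup>2) \<Longrightarrow> midpoint_log_concave_on S f"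
  by (simp add: midpoint_log_concave_on_def)

lemma midpoint_log_concave_onD:
  "midpoint_log_concave_on S f \<Longrightarrow> x \<in> S \<Longrightarrow> y \<in> S \<Longrightarrow> f x * f y \<le> (f ((x + y) / 2))\<^sup>2"
  by (simp add: midpoint_log_concave_on_def)

lemma mult_less_midpoint_square:
  fixes u v :: real
  assumes "u \<noteq> v"
  shows "u * v < ((u + v) / 2)\<^sup>2"
proof -
  have "((u + v) / 2)\<^sup>2 - u * v = ((u - v) / 2)\<^sup>2" by (simp add: power2_eq_square field_simps)
  moreover have "\<dots> > 0" using assms by simp
  ultimately show ?thesis by linarith
qed

lemma midpoint_log_concave_powr_mult_strict:
  assumes g: "midpoint_log_concave_on S g" and S: "u \<in> S" "v \<in> S" and s: "0 < s"
    and uv: "0 < u" "0 < v" "u \<noteq> v" and g_pos: "0 < g u" "0 < g v"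
  shows "(u powr s * g u) * (v powr s * g v) < (((u + v) / 2) powr s * g ((u + v) / 2))\<^sup>2"
proof -
  define m where "m = (u + v) / 2"
  have "0 < m" using uv by (simp add: m_def)
  have "(u * v) powr s < (m\<^sup>2) powr s"
    using mult_less_midpoint_square uv s unfolding m_def by (intro powr_less_mono2) auto
  then have powr: "u powr s * v powr s < (m powr s)\<^sup>2"
    using uv \<open>0 < m\<close> by (simp add: powr_mult power2_eq_square)
  have "(u powr s * g u) * (v powr s * g v) = (u powr s * v powr s) * (g u * g v)"
    by simp
  also have "\<dots> < (m powr s)\<^sup>2 * (g u * g v)"
    using powr g_pos by (intro mult_strict_right_mono) auto
  also have "\<dots> \<le> (m powr s)\<^sup>2 * (g m)\<^sup>2"
    using midpoint_log_concave_onD[OF g S] by (intro mult_left_mono) (simp_all add: m_def)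
  finally show ?thesis by (simp only: power_mult_distrib m_def)
qed

lemma powr_mult_line_max_slope:
  fixes w :: real
  assumes w: "0 < w" and d: "0 < d"
    and max: "\<And>y. \<bar>w - y\<bar> < d \<Longrightarrow> y powr s * (c + m * (y - w)) \<le> w powr s * c"
  shows "m = - (s * c / w)"
proof -
  define H where "H y = y powr s * (c + m * (y - w))" for y
  have "((\<lambda>y. c + m * (y - w)) has_real_derivative m) (at w)"
    by (auto intro!: derivative_eq_intros)
  from DERIV_mult[OF has_real_derivative_powr[OF w, of s] this]
  have "(H has_real_derivative s * w powr (s - 1) * c + w powr s * m) (at w)"
    unfolding H_def by (simp add: mult_ac)
  then have "s * w powr (s - 1) * c + w powr s * m = 0"
    using d by (rule DERIV_local_max) (use max in \<open>simp add: H_def\<close>)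
  moreover have "w powr s = w powr (s - 1) * w"
    using w by (simp add: powr_diff)
  ultimately have "w powr (s - 1) * (s * c + w * m) = 0" by (simp add: algebra_simps)
  then have "s * c + w * m = 0" using w by simp
  then show ?thesis using w by (simp add: field_simps)
qed

text \<open>
  No differentiability of \<open>g\<close> is needed: multiplied by \<open>u powr s\<close>, any supporting line of \<open>g\<close> at the
  maximizer lies below \<open>u powr s * g u\<close> and touches it there, which determines its slope.
\<close>

lemma convex_on_above_line_at_powr_mult_max:
  assumes g: "convex_on I g" and J: "open J" "J \<subseteq> I" and w: "w \<in> J" "0 < w"
    and max: "\<And>y. y \<in> J \<Longrightarrow> y powr s * g y \<le> w powr s * g w" and u: "u \<in> I"
  shows "g w * (1 + s * (1 - u / w)) \<le> g u"
proof -
  have "w \<in> interior I" using J w by (meson interiorI)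
  then obtain m where line: "\<And>y. y \<in> I \<Longrightarrow> g w + m * (y - w) \<le> g y"
    using convex_le_Inf_differential[OF g] by blast
  obtain d where d: "0 < d" "ball w d \<subseteq> J" using J(1) w(1) by (rule openE)
  have slope: "m = - (s * g w / w)"
  proof (rule powr_mult_line_max_slope[OF w(2) d(1)])
    fix y assume "\<bar>w - y\<bar> < d"
    then have y: "y \<in> J" using d(2) by (auto simp: subset_iff dist_real_def)
    then have "y powr s * (g w + m * (y - w)) \<le> y powr s * g y"
      using J(2) by (intro mult_left_mono line) auto
    then show "y powr s * (g w + m * (y - w)) \<le> w powr s * g w"
      using max[OF y] by linarith
  qed
  have "g w * (1 + s * (1 - u / w)) = g w + m * (u - w)"
    unfolding slope using w by (simp add: field_simps)
  then show ?thesis using line[OF u] by simp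
qed

definition decay_profile_on :: "real set \<Rightarrow> (real \<Rightarrow> real) \<Rightarrow> bool" where
  "decay_profile_on S f \<longleftrightarrow>
    convex_on S f \<and> antimono_on S f \<and> midpoint_log_concave_on S f \<and> (\<forall>x\<in>S. 0 \<le> f x)"

lemma decay_profile_onD:
  assumes "decay_profile_on S f"
  shows "convex_on S f" "antimono_on S f" "midpoint_log_concave_on S f" "convex S"
    "x \<in> S \<Longrightarrow> 0 \<le> f x"
  using assms by (auto simp: decay_profile_on_def convex_on_imp_convex)

lemma decay_profile_on_antimonoD:
  "decay_profile_on S f \<Longrightarrow> x \<in> S \<Longrightarrow> y \<in> S \<Longrightarrow> x \<le> y \<Longrightarrow> f y \<le> f x"
  by (simp add: decay_profile_on_def monotone_on_def)

abbreviation initial_segment :: "ereal \<Rightarrow> real set" where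
  "initial_segment z \<equiv> {u. 0 \<le> u \<and> ereal u \<le> z}"

locale power_profile =
  fixes a :: real and z :: ereal and g \<Phi> :: "real \<Rightarrow> real"
  assumes a_pos: "0 < a" and z_pos: "0 < z"
    and profile: "decay_profile_on (initial_segment z) g"
    and g_pos: "\<And>u. 0 \<le> u \<Longrightarrow> ereal u < z \<Longrightarrow> 0 < g u"
    and g_zero: "\<And>r. z = ereal r \<Longrightarrow> g r = 0"
    and tendsto_at_top: "z = \<infinity> \<Longrightarrow> (\<Phi> \<longlongrightarrow> 0) at_top"
    and Phi: "\<And>u. 0 \<le> u \<Longrightarrow> ereal u \<le> z \<Longrightarrow> \<Phi> u = u powr (a/2) * g u"
begin

lemma einterval_subset_initial_segment: "einterval 0 z \<subseteq> initial_segment z"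
  by (auto simp: einterval_iff)

lemma convex_on_g: "convex_on (initial_segment z) g"
  by (rule decay_profile_onD(1)[OF profile])

lemma Phi_einterval: "u \<in> einterval 0 z \<Longrightarrow> \<Phi> u = u powr (a/2) * g u"
  using einterval_subset_initial_segment by (intro Phi) auto

lemma Phi_pos: "u \<in> einterval 0 z \<Longrightarrow> 0 < \<Phi> u"
  using Phi_einterval[of u] g_pos[of u] by (simp add: einterval_iff)

lemma Phi_nonneg: "0 \<le> u \<Longrightarrow> ereal u \<le> z \<Longrightarrow> 0 \<le> \<Phi> u"
  using Phi[of u] decay_profile_onD(5)[OF profile, of u] by simp

lemma g_le_g_0: "0 \<le> u \<Longrightarrow> ereal u \<le> z \<Longrightarrow> g u \<le> g 0"
  using z_pos by (intro decay_profile_on_antimonoD[OF profile]) (auto simp: zero_ereal_def)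

lemma einterval_downward:
  assumes "v \<in> einterval 0 z" "0 < u" "u \<le> v"
  shows "u \<in> einterval 0 z"
proof -
  have "ereal u \<le> ereal v" using assms by simp
  also have "\<dots> < z" using assms by (simp add: einterval_iff)
  finally show ?thesis using assms by (simp add: einterval_iff)
qed

lemma continuous_on_Phi: "continuous_on (einterval 0 z) \<Phi>"
proof -
  have "convex (einterval 0 z)" by (rule is_interval_convex[OF is_interval_einterval])
  then have "continuous_on (einterval 0 z) g"
    by (intro convex_on_continuous open_einterval
        convex_on_subset[OF convex_on_g einterval_subset_initial_segment])
  then have "continuous_on (einterval 0 z) (\<lambda>u. u powr (a/2) * g u)"
    by (intro continuous_intros) (auto simp: einterval_iff)
  then show ?thesis
    by (rule continuous_on_eq) (simp add: Phi_einterval)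
qed

lemma Phi_tendsto_0: "(\<Phi> \<longlongrightarrow> 0) (at_right 0)"
proof (rule tendsto_sandwich)
  obtain v where v: "0 < v" "ereal v < z"
    using ereal_dense2[OF z_pos] by (auto simp: zero_ereal_def)
  have near: "\<forall>\<^sub>F u in at_right 0. u \<in> {0<..<v}" by (rule eventually_at_right_real[OF v(1)])
  have le_z: "ereal u \<le> z" if "u < v" for u
    using that v(2) by (meson ereal_less_eq(3) le_less_trans less_imp_le)
  show "\<forall>\<^sub>F u in at_right 0. 0 \<le> \<Phi> u"
    using near by eventually_elim (use Phi_nonneg le_z in auto)
  show "\<forall>\<^sub>F u in at_right 0. \<Phi> u \<le> u powr (a/2) * g 0"
    using near by eventually_elim (use Phi g_le_g_0 le_z in \<open>auto intro!: mult_left_mono\<close>)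
  have "((\<lambda>u::real. u powr (a/2)) \<longlongrightarrow> 0) (at_right 0)"
    using tendsto_powr2[of "\<lambda>u. u" 0 "at_right (0::real)" "\<lambda>_. a/2" "a/2"] a_pos
    by (auto simp: eventually_at_filter intro!: tendsto_ident_at always_eventually)
  from tendsto_mult_right[OF this, of "g 0"]
  show "((\<lambda>u::real. u powr (a/2) * g 0) \<longlongrightarrow> 0) (at_right 0)" by simp
qed simp

lemma Phi_tendsto_first_zero:
  assumes z: "z = ereal r"
  shows "(\<Phi> \<longlongrightarrow> 0) (at_left r)"
proof (rule tendsto_sandwich)
  have r: "0 < r" using z_pos z by simp
  then have near: "\<forall>\<^sub>F u in at_left r. u \<in> {0<..<r}" by (rule eventually_at_left_real)
  have "{0..r} \<subseteq> initial_segment z" using z by auto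
  note convex = convex_on_subset[OF convex_on_g this]
  show "\<forall>\<^sub>F u in at_left r. 0 \<le> \<Phi> u"
    using near by eventually_elim (use Phi_nonneg z in auto)
  show "\<forall>\<^sub>F u in at_left r. \<Phi> u \<le> r powr (a/2) * (g 0 / r * (r - u))"
    using near
  proof eventually_elim
    case (elim u)
    have "g u \<le> g 0 / r * (r - u)"
      using convex_onD_Icc''[of 0 r g u] convex elim g_zero[OF z] by simp
    then have "u powr (a/2) * g u \<le> r powr (a/2) * (g 0 / r * (r - u))"
      using elim g_pos[of u] z a_pos by (intro mult_mono powr_mono2) auto
    then show ?case using elim Phi[of u] z by simp
  qed
  have "((\<lambda>u. r powr (a/2) * (g 0 / r * (r - u))) \<longlongrightarrow> r powr (a/2) * (g 0 / r * (r - r))) (at_left r)"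
    by (intro tendsto_intros)
  then show "((\<lambda>u. r powr (a/2) * (g 0 / r * (r - u))) \<longlongrightarrow> 0) (at_left r)" by simp
qed simp

abbreviation maximizer :: "real \<Rightarrow> bool" where
  "maximizer \<equiv> is_arg_max \<Phi> (\<lambda>u. u \<in> einterval 0 z)"

lemma maximizerD:
  assumes "maximizer w"
  shows "w \<in> einterval 0 z" "0 < w" "u \<in> einterval 0 z \<Longrightarrow> \<Phi> u \<le> \<Phi> w"
  using assms by (auto simp: is_arg_max_linorder einterval_iff)

lemma maximizer_exists: "\<exists>w. maximizer w"
proof -
  obtain v where v: "v \<in> einterval 0 z"
    using ereal_dense2[OF z_pos] by (auto simp: einterval_iff)
  have at_0: "((\<Phi> \<circ> real_of_ereal) \<longlongrightarrow> 0) (at_right 0)"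
    using Phi_tendsto_0 unfolding zero_ereal_def ereal_tendsto_simps .
  have at_z: "((\<Phi> \<circ> real_of_ereal) \<longlongrightarrow> 0) (at_left z)"
  proof (cases z)
    case (real r)
    then show ?thesis using Phi_tendsto_first_zero[OF real] by (simp add: ereal_tendsto_simps)
  next
    case PInf
    then show ?thesis using tendsto_at_top by (simp add: ereal_tendsto_simps)
  qed (use z_pos in auto)
  show ?thesis
    using order_tendstoD(2)[OF at_0 Phi_pos[OF v]] order_tendstoD(2)[OF at_z Phi_pos[OF v]]
    by (intro continuous_on_einterval_attains_max[OF continuous_on_Phi v]) simp_all
qed

lemma maximizer_unique:
  assumes u_max: "maximizer u" and v_max: "maximizer v"
  shows "u = v"
proof (rule ccontr)
  assume neq: "u \<noteq> v"
  let ?m = "(u + v) / 2"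
  note u = maximizerD[OF u_max] and v = maximizerD[OF v_max]
  have "max u v \<in> einterval 0 z" using u(1) v(1) by (simp add: max_def)
  then have m: "?m \<in> einterval 0 z"
    by (rule einterval_downward) (use u(2) v(2) in auto)
  have "(u powr (a/2) * g u) * (v powr (a/2) * g v) < (?m powr (a/2) * g ?m)\<^sup>2"
    using u v neq a_pos g_pos einterval_subset_initial_segment
    by (intro midpoint_log_concave_powr_mult_strict[OF decay_profile_onD(3)[OF profile]])
       (auto simp: einterval_iff)
  then have "\<Phi> u * \<Phi> v < (\<Phi> ?m)\<^sup>2"
    using Phi_einterval u(1) v(1) m by simp
  moreover have "(\<Phi> ?m)\<^sup>2 \<le> \<Phi> u * \<Phi> v"
    unfolding power2_eq_square using u(3)[OF m] v(3)[OF m] Phi_pos u(1) m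
    by (intro mult_mono) (auto intro: less_imp_le)
  ultimately show False by simp
qed

lemma g_above_line:
  assumes w: "maximizer w" and u: "0 \<le> u" "ereal u \<le> z"
  shows "g w * (1 + a/2 * (1 - u / w)) \<le> g u"
proof (rule convex_on_above_line_at_powr_mult_max[OF convex_on_g open_einterval
      einterval_subset_initial_segment])
  fix y assume y: "y \<in> einterval 0 z"
  show "y powr (a/2) * g y \<le> w powr (a/2) * g w"
    using maximizerD(3)[OF w y] Phi_einterval[OF y] Phi_einterval[OF maximizerD(1)[OF w]] by simp
qed (use maximizerD(1,2)[OF w] u in auto)

lemma stretched_maximizer_le_first_zero:
  assumes w: "maximizer w"
  shows "ereal ((1 + 2/a) * w) \<le> z"
proof (cases z)
  case (real r)
  have "0 \<le> r" using real z_pos by simp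
  then have "g w * (1 + a/2 * (1 - r / w)) \<le> 0"
    using g_above_line[OF w, of r] g_zero[OF real] real by simp
  moreover have "0 < g w" using g_pos maximizerD[OF w] by (simp add: einterval_iff)
  ultimately have "1 + a/2 * (1 - r / w) \<le> 0" by (simp add: mult_le_0_iff)
  then have "(1 + 2/a) * w \<le> r" using a_pos maximizerD(2)[OF w] by (simp add: field_simps)
  then show ?thesis using real by simp
qed (use z_pos in auto)

lemma Phi_ge_minorant:
  assumes w: "maximizer w" and u: "0 \<le> u" "u \<le> (1 + 2/a) * w"
  shows "\<Phi> w * minorant a (u / w) \<le> \<Phi> u"
proof -
  have w0: "0 < w" "ereal w \<le> z" using maximizerD[OF w] by (auto simp: einterval_iff)
  have "ereal u \<le> ereal ((1 + 2/a) * w)" using u(2) by simp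
  then have uz: "ereal u \<le> z" using stretched_maximizer_le_first_zero[OF w] by (rule order_trans)
  have "\<Phi> w * minorant a (u / w) = u powr (a/2) * (g w * (1 + a/2 * (1 - u / w)))"
    using Phi[of w] w0 u(1) by (simp add: minorant_def powr_divide)
  also have "\<dots> \<le> u powr (a/2) * g u"
    by (intro mult_left_mono g_above_line[OF w u(1) uz]) simp
  also have "\<dots> = \<Phi> u" using Phi[OF u(1) uz] by simp
  finally show ?thesis .
qed

lemma Phi_ratio_ge_minorant:
  assumes w: "maximizer w" and t: "0 \<le> t" "t \<le> 1 + 2/a"
  shows "minorant a t \<le> \<Phi> (t * w) / \<Phi> w"
  using Phi_ge_minorant[OF w, of "t * w"] t maximizerD[OF w] Phi_pos[of w]
  by (simp add: le_divide_eq mult.commute[of "\<Phi> w"] mult_right_mono)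

lemma minorant_square_le_Phi_square:
  assumes w: "maximizer w" and u: "0 < u" "u \<le> (1 + 2/a) * w"
  shows "(\<Phi> w)\<^sup>2 * ((minorant a (u / w))\<^sup>2 / u) \<le> (\<Phi> u)\<^sup>2 / u"
proof -
  have "0 < w" "0 < \<Phi> w" using maximizerD[OF w] Phi_pos by auto
  moreover from this have "0 \<le> minorant a (u / w)"
    using u by (intro minorant_nonneg a_pos) (simp add: divide_le_eq)
  ultimately have "(\<Phi> w * minorant a (u / w))\<^sup>2 \<le> (\<Phi> u)\<^sup>2"
    using Phi_ge_minorant[OF w] u by (intro power_mono) auto
  then show ?thesis using u by (simp add: power_mult_distrib divide_right_mono)
qed

text \<open>Only integrability of \<open>(\<Phi> u)\<^sup>2 / u\<close> near \<open>0\<close> is at stake, so the constant is immaterial.\<close>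

lemma Phi_square_le_minorant_square:
  assumes w: "maximizer w" and u: "0 < u" "u < w"
  shows "(\<Phi> u)\<^sup>2 / u \<le> (w powr (a/2) * g 0)\<^sup>2 * ((minorant a (u / w))\<^sup>2 / u)"
proof -
  have w0: "0 < w" by (rule maximizerD(2)[OF w])
  have "u \<in> einterval 0 z" by (rule einterval_downward[OF maximizerD(1)[OF w]]) (use u in auto)
  then have uz: "ereal u \<le> z" using einterval_subset_initial_segment by auto
  have "(u / w) powr (a/2) * 1 \<le> minorant a (u / w)"
    unfolding minorant_def using u w0 a_pos by (intro mult_left_mono) auto
  moreover have "u powr (a/2) = w powr (a/2) * (u / w) powr (a/2)"
    using u w0 by (simp add: powr_divide)
  moreover have "0 \<le> minorant a (u / w)"
    unfolding minorant_def using u w0 a_pos by simp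
  ultimately have "\<Phi> u \<le> w powr (a/2) * minorant a (u / w) * g 0"
    using Phi[of u] u uz g_le_g_0[of u] decay_profile_onD(5)[OF profile, of u]
    by (auto intro!: mult_mono)
  then have "(\<Phi> u)\<^sup>2 \<le> (w powr (a/2) * minorant a (u / w) * g 0)\<^sup>2"
    using Phi_nonneg[of u] u uz by (intro power_mono) auto
  then show ?thesis using u by (simp add: power_mult_distrib divide_right_mono mult_ac)
qed

lemma Phi_square_set_integrable:
  assumes w: "maximizer w"
  shows "set_integrable lborel {0<..<w} (\<lambda>u. (\<Phi> u)\<^sup>2 / u)"
proof (rule set_integrable_bound)
  have w0: "0 < w" by (rule maximizerD(2)[OF w])
  show "set_integrable lborel {0<..<w} (\<lambda>u. (w powr (a/2) * g 0)\<^sup>2 * ((minorant a (u / w))\<^sup>2 / u))"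
    by (intro set_integrable_mult_right minorant_integral a_pos w0)
  show "AE u in lborel. u \<in> {0<..<w} \<longrightarrow>
      norm ((\<Phi> u)\<^sup>2 / u) \<le> norm ((w powr (a/2) * g 0)\<^sup>2 * ((minorant a (u / w))\<^sup>2 / u))"
    using Phi_square_le_minorant_square[OF w] by (simp add: abs_mult)
  have "{0<..<w} \<subseteq> einterval 0 z" using einterval_downward[OF maximizerD(1)[OF w]] by auto
  then have "continuous_on {0<..<w} (\<lambda>u. (\<Phi> u)\<^sup>2 / u)"
    by (intro continuous_intros continuous_on_subset[OF continuous_on_Phi]) auto
  then have "(\<lambda>u. indicator {0<..<w} u *\<^sub>R ((\<Phi> u)\<^sup>2 / u)) \<in> borel_measurable borel"
    by (intro borel_measurable_continuous_on_indicator) auto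
  then show "set_borel_measurable lborel {0<..<w} (\<lambda>u. (\<Phi> u)\<^sup>2 / u)"
    by (simp add: set_borel_measurable_def)
qed

lemma integral_lower_bound:
  assumes w: "maximizer w"
  shows "(\<Phi> w)\<^sup>2 / a * R a \<le> (LBINT u=0..ereal w. (\<Phi> u)\<^sup>2 / u)"
proof -
  have w0: "0 < w" by (rule maximizerD(2)[OF w])
  have "(\<Phi> w)\<^sup>2 / a * R a = (\<Phi> w)\<^sup>2 * minorant_moment a (w / w)"
    using w0 a_pos by (simp flip: minorant_moment_1)
  also have "\<dots> = (LBINT u:{0<..<w}. (\<Phi> w)\<^sup>2 * ((minorant a (u / w))\<^sup>2 / u))"
    by (simp only: set_integral_mult_right minorant_integral(2)[OF a_pos w0 w0])
  also have "\<dots> \<le> (LBINT u:{0<..<w}. (\<Phi> u)\<^sup>2 / u)"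
  proof (rule set_integral_mono)
    show "set_integrable lborel {0<..<w} (\<lambda>u. (\<Phi> w)\<^sup>2 * ((minorant a (u / w))\<^sup>2 / u))"
      by (intro set_integrable_mult_right minorant_integral a_pos w0)
    fix u assume u: "u \<in> {0<..<w}"
    then have "u \<le> (1 + 2/a) * w" using a_pos w0 by (simp add: distrib_right add_increasing2)
    then show "(\<Phi> w)\<^sup>2 * ((minorant a (u / w))\<^sup>2 / u) \<le> (\<Phi> u)\<^sup>2 / u"
      using u by (intro minorant_square_le_Phi_square[OF w]) auto
  qed (rule Phi_square_set_integrable[OF w])
  also have "\<dots> = (LBINT u=0..ereal w. (\<Phi> u)\<^sup>2 / u)"
    using w0 by (simp add: interval_lebesgue_integral_def zero_ereal_def)
  finally show ?thesis .
qed

end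

locale extended_power_profile = power_profile +
  fixes L :: ereal
  assumes first_zero_less_L: "\<And>u. ereal u \<le> z \<Longrightarrow> ereal u < L"
    and Phi_measurable: "set_borel_measurable borel (einterval 0 L) \<Phi>"
    and Phi_nonzero: "AE u in lborel. u \<in> einterval 0 L \<longrightarrow> \<Phi> u \<noteq> 0"
begin

lemma not_AE_Phi_zero:
  assumes p: "0 \<le> p" "ereal p < L"
  shows "\<not> (AE u in lborel. p < u \<longrightarrow> ereal u < L \<longrightarrow> \<Phi> u = 0)"
proof
  assume zero: "AE u in lborel. p < u \<longrightarrow> ereal u < L \<longrightarrow> \<Phi> u = 0"
  obtain q where q: "p < q" "ereal q < L" using ereal_dense2[OF p(2)] by auto
  have "AE u in lborel. u \<notin> {p<..<q}"
    using zero Phi_nonzero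
    by eventually_elim (use p q in \<open>auto simp: einterval_iff intro: less_trans[of _ "ereal q"]\<close>)
  then have "{p<..<q} \<in> null_sets lborel" by (simp add: AE_iff_null_sets)
  then show False using q by (simp add: null_sets_def)
qed

lemma inverse_moment_integrand_measurable:
  "(\<lambda>u. ennreal ((\<Phi> u)\<^sup>2 / u) * indicator (einterval 0 L) u) \<in> borel_measurable borel"
proof -
  have "(\<lambda>u. ennreal ((\<Phi> u)\<^sup>2 / u) * indicator (einterval 0 L) u)
      = (\<lambda>u. ennreal ((indicator (einterval 0 L) u *\<^sub>R \<Phi> u)\<^sup>2 / u))"
    by (auto simp: indicator_def)
  then show ?thesis using Phi_measurable by (simp add: set_borel_measurable_def)
qed

lemma minorant_moment_less_inverse_moment:
  assumes w: "maximizer w"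
  shows "ennreal ((\<Phi> w)\<^sup>2 * minorant_moment a (1 + 2/a)) < inverse_moment \<Phi> L"
proof -
  have w0: "0 < w" by (rule maximizerD(2)[OF w])
  define p where "p = (1 + 2/a) * w"
  have p: "0 < p" "ereal p < L"
    using a_pos w0 stretched_maximizer_le_first_zero[OF w]
    by (auto simp: p_def add_pos_pos intro: first_zero_less_L)
  define f where "f u = ennreal ((\<Phi> w)\<^sup>2 * ((minorant a (u / w))\<^sup>2 / u)) * indicator {0<..<p} u" for u
  define h where "h u = ennreal ((\<Phi> u)\<^sup>2 / u) * indicator (einterval 0 L) u" for u
  have f_integral: "(\<integral>\<^sup>+u. f u \<partial>lborel) = ennreal ((\<Phi> w)\<^sup>2 * minorant_moment a (1 + 2/a))"
    unfolding f_def using minorant_nn_integral[OF a_pos w0 p(1), of "(\<Phi> w)\<^sup>2"] w0 by (simp add: p_def)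
  have f_le_h: "f u \<le> h u" for u
  proof (cases "u \<in> {0<..<p}")
    case True
    then have "ereal u < ereal p" by simp
    also note \<open>ereal p < L\<close>
    finally show ?thesis
      using True minorant_square_le_Phi_square[OF w, of u]
      by (auto simp: f_def h_def p_def einterval_iff intro!: ennreal_leI)
  qed (simp add: f_def)
  have "\<not> (AE u in lborel. h u \<le> f u)"
  proof
    assume "AE u in lborel. h u \<le> f u"
    then have "AE u in lborel. p < u \<longrightarrow> ereal u < L \<longrightarrow> \<Phi> u = 0"
      by eventually_elim (use p(1) in \<open>auto simp: h_def f_def einterval_iff ennreal_eq_0_iff divide_le_0_iff\<close>)
    then show False using not_AE_Phi_zero p by simp
  qed
  then have "(\<integral>\<^sup>+u. f u \<partial>lborel) < (\<integral>\<^sup>+u. h u \<partial>lborel)"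
    using f_le_h inverse_moment_integrand_measurable f_integral
    by (intro nn_integral_less) (simp_all add: f_def[abs_def] h_def[abs_def] minorant_def)
  then show ?thesis unfolding f_integral by (simp add: inverse_moment_def h_def)
qed

lemma maximum_square_less_inverse_moment:
  assumes w: "maximizer w" and finite: "inverse_moment \<Phi> L < \<infinity>"
  shows "(\<Phi> w)\<^sup>2 < a * enn2real (inverse_moment \<Phi> L) / R_star a"
proof -
  have "(\<Phi> w)\<^sup>2 * minorant_moment a (1 + 2/a) < enn2real (inverse_moment \<Phi> L)"
    using minorant_moment_less_inverse_moment[OF w] finite
    by (cases "inverse_moment \<Phi> L") (auto simp flip: not_le dest: ennreal_leI)
  then have "(\<Phi> w)\<^sup>2 * R_star a < a * enn2real (inverse_moment \<Phi> L)"
    using a_pos by (simp add: R_star_eq_minorant_moment)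
  then show ?thesis using R_star_pos[OF a_pos] by (simp add: less_divide_eq)
qed

end

subsection \<open>Closure properties of decay profiles\<close>

lemma convex_on_mult_antimono:
  fixes S :: "real set"
  assumes f: "convex_on S f" "antimono_on S f" "\<And>x. x \<in> S \<Longrightarrow> 0 \<le> f x"
    and g: "convex_on S g" "antimono_on S g" "\<And>x. x \<in> S \<Longrightarrow> 0 \<le> g x"
  shows "convex_on S (\<lambda>x. f x * g x)"
proof (rule convex_on_linorderI)
  show convex: "convex S" by (rule convex_on_imp_convex[OF f(1)])
  fix t x y :: real assume t: "0 < t" "t < 1" and xy: "x \<in> S" "y \<in> S" "x < y"
  let ?m = "(1 - t) *\<^sub>R x + t *\<^sub>R y"
  have m: "?m \<in> S" using convexD_alt[OF convex xy(1,2)] t by simp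
  have "f ?m * g ?m \<le> ((1 - t) * f x + t * f y) * ((1 - t) * g x + t * g y)"
    using convex_onD[OF f(1), of t x y] convex_onD[OF g(1), of t x y] t xy f(3) g(3) m
    by (intro mult_mono) auto
  also have "\<dots> = (1 - t) * (f x * g x) + t * (f y * g y) - t * (1 - t) * ((f x - f y) * (g x - g y))"
    by algebra
  also have "\<dots> \<le> (1 - t) * (f x * g x) + t * (f y * g y)"
  proof -
    have "f y \<le> f x" "g y \<le> g x" using f(2) g(2) xy by (auto simp: monotone_on_def)
    then show ?thesis using t by simp
  qed
  finally show "f ?m * g ?m \<le> (1 - t) * (f x * g x) + t * (f y * g y)" .
qed

lemma antimono_on_mult:
  fixes f g :: "'a::order \<Rightarrow> 'b::ordered_semiring"
  assumes "antimono_on S f" "\<And>x. x \<in> S \<Longrightarrow> 0 \<le> f x" "antimono_on S g" "\<And>x. x \<in> S \<Longrightarrow> 0 \<le> g x"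
  shows "antimono_on S (\<lambda>x. f x * g x)"
  using assms by (auto simp: monotone_on_def intro!: mult_mono)

lemma midpoint_log_concave_on_mult:
  assumes f: "midpoint_log_concave_on S f"
    and g: "midpoint_log_concave_on S g" "\<And>x. x \<in> S \<Longrightarrow> 0 \<le> g x"
  shows "midpoint_log_concave_on S (\<lambda>x. f x * g x)"
proof (rule midpoint_log_concave_onI)
  fix x y assume xy: "x \<in> S" "y \<in> S"
  let ?m = "(x + y) / 2"
  have "(f x * f y) * (g x * g y) \<le> (f ?m)\<^sup>2 * (g ?m)\<^sup>2"
    using midpoint_log_concave_onD[OF f xy] midpoint_log_concave_onD[OF g(1) xy] g(2) xy
    by (intro mult_mono) auto
  then show "f x * g x * (f y * g y) \<le> (f ?m * g ?m)\<^sup>2"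
    by (simp add: power_mult_distrib mult_ac)
qed

lemma midpoint_log_concave_on_linear: "midpoint_log_concave_on S (\<lambda>x. p + k * x)"
proof (rule midpoint_log_concave_onI)
  fix x y
  have "(p + k * ((x + y) / 2))\<^sup>2 - (p + k * x) * (p + k * y) = (k * (x - y) / 2)\<^sup>2"
    by (simp add: power2_eq_square field_simps)
  then show "(p + k * x) * (p + k * y) \<le> (p + k * ((x + y) / 2))\<^sup>2"
    by (metis diff_ge_0_iff_ge zero_le_power2)
qed

lemma midpoint_log_concave_on_powr:
  assumes f: "midpoint_log_concave_on S f" "\<And>x. x \<in> S \<Longrightarrow> 0 \<le> f x" and s: "0 \<le> s" and S: "convex S"
  shows "midpoint_log_concave_on S (\<lambda>x. f x powr s)"
proof (rule midpoint_log_concave_onI)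
  fix x y assume xy: "x \<in> S" "y \<in> S"
  define m where "m = (x + y) / 2"
  have "m \<in> S" using convexD[OF S xy, of "1/2" "1/2"] by (simp add: m_def add_divide_distrib)
  then have "0 \<le> f x" "0 \<le> f y" "0 \<le> f m" using f(2) xy by auto
  moreover have "(f x * f y) powr s \<le> ((f m)\<^sup>2) powr s"
    using midpoint_log_concave_onD[OF f(1) xy] calculation s unfolding m_def by (intro powr_mono2) auto
  ultimately have "f x powr s * f y powr s \<le> (f m powr s)\<^sup>2"
    by (simp add: powr_mult power2_eq_square)
  then show "f x powr s * f y powr s \<le> (f ((x + y) / 2) powr s)\<^sup>2"
    unfolding m_def .
qed

lemma decay_profile_on_mult:
  assumes "decay_profile_on S f" "decay_profile_on S g"
  shows "decay_profile_on S (\<lambda>x. f x * g x)"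
  using assms unfolding decay_profile_on_def
  by (auto intro: convex_on_mult_antimono antimono_on_mult midpoint_log_concave_on_mult)

lemma decay_profile_on_const: "convex S \<Longrightarrow> 0 \<le> k \<Longrightarrow> decay_profile_on S (\<lambda>_. k)"
  using midpoint_log_concave_on_linear[of S k 0]
  by (simp add: decay_profile_on_def convex_on_const monotone_on_def)

lemma decay_profile_on_linear:
  assumes "convex S" "0 \<le> k" "\<And>x. x \<in> S \<Longrightarrow> k * x \<le> 1"
  shows "decay_profile_on S (\<lambda>x. 1 - k * x)"
  unfolding decay_profile_on_def
proof (intro conjI ballI)
  show "convex_on S (\<lambda>x. 1 - k * x)"
    by (intro convex_onI assms(1)) (simp add: algebra_simps)
  show "antimono_on S (\<lambda>x. 1 - k * x)"
    using assms(2) by (auto intro!: monotone_onI mult_left_mono)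
  show "midpoint_log_concave_on S (\<lambda>x. 1 - k * x)"
    using midpoint_log_concave_on_linear[of S 1 "- k"] by simp
qed (use assms(3) in simp)

lemma decay_profile_on_exp:
  assumes "convex S" "0 \<le> k"
  shows "decay_profile_on S (\<lambda>x. exp (- k * x))"
  unfolding decay_profile_on_def
proof (intro conjI ballI)
  show "convex_on S (\<lambda>x. exp (- k * x))"
    by (rule f''_ge0_imp_convex[OF assms(1), where f' = "\<lambda>x. - k * exp (- k * x)"
          and f'' = "\<lambda>x. k\<^sup>2 * exp (- k * x)"])
       (auto intro!: derivative_eq_intros simp: power2_eq_square)
  show "antimono_on S (\<lambda>x. exp (- k * x))"
    using assms(2) by (auto intro!: monotone_onI mult_left_mono)
  show "midpoint_log_concave_on S (\<lambda>x. exp (- k * x))"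
    by (intro midpoint_log_concave_onI)
       (simp add: power2_eq_square field_simps flip: exp_add)
qed simp

lemma decay_profile_on_prod:
  assumes "convex S" "\<And>i. i \<in> A \<Longrightarrow> decay_profile_on S (f i)"
  shows "decay_profile_on S (\<lambda>x. \<Prod>i\<in>A. f i x)"
  using assms(2)
proof (induction A rule: infinite_finite_induct)
  case (insert i A)
  then show ?case using decay_profile_on_mult[of S "f i"] by simp
qed (use assms(1) in \<open>auto intro!: decay_profile_on_const\<close>)

lemma convex_on_LIMSEQ:
  assumes f: "\<And>n. convex_on S (f n)" and lim: "\<And>x. x \<in> S \<Longrightarrow> (\<lambda>n. f n x) \<longlonglongrightarrow> h x"
  shows "convex_on S h"
proof (rule convex_onI)
  show S: "convex S" by (rule convex_on_imp_convex[OF f])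
  fix t :: real and x y assume t: "0 < t" "t < 1" and xy: "x \<in> S" "y \<in> S"
  let ?m = "(1 - t) *\<^sub>R x + t *\<^sub>R y"
  have "?m \<in> S" using convexD_alt[OF S xy] t by simp
  then have "(\<lambda>n. f n ?m) \<longlonglongrightarrow> h ?m" by (rule lim)
  moreover have "(\<lambda>n. (1 - t) * f n x + t * f n y) \<longlonglongrightarrow> (1 - t) * h x + t * h y"
    using xy by (intro tendsto_intros lim)
  ultimately show "h ?m \<le> (1 - t) * h x + t * h y"
    using convex_onD[OF f] t xy by (intro LIMSEQ_le) auto
qed

lemma antimono_on_LIMSEQ:
  fixes f :: "nat \<Rightarrow> 'a::order \<Rightarrow> 'b::linorder_topology"
  assumes f: "\<And>n. antimono_on S (f n)" and lim: "\<And>x. x \<in> S \<Longrightarrow> (\<lambda>n. f n x) \<longlonglongrightarrow> h x"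
  shows "antimono_on S h"
proof (rule monotone_onI)
  fix x y assume "x \<in> S" "y \<in> S" "x \<le> y"
  then show "h y \<le> h x"
    using f by (intro LIMSEQ_le[OF lim lim]) (auto simp: monotone_on_def)
qed

lemma midpoint_log_concave_on_LIMSEQ:
  assumes f: "\<And>n. midpoint_log_concave_on S (f n)" and S: "convex S"
    and lim: "\<And>x. x \<in> S \<Longrightarrow> (\<lambda>n. f n x) \<longlonglongrightarrow> h x"
  shows "midpoint_log_concave_on S h"
proof (rule midpoint_log_concave_onI)
  fix x y assume xy: "x \<in> S" "y \<in> S"
  have m: "(x + y) / 2 \<in> S" using convexD[OF S xy, of "1/2" "1/2"] by (simp add: add_divide_distrib)
  show "h x * h y \<le> (h ((x + y) / 2))\<^sup>2"
    using midpoint_log_concave_onD[OF f xy]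
    by (intro LIMSEQ_le[OF tendsto_mult[OF lim lim] tendsto_power[OF lim]] xy m) auto
qed

lemma decay_profile_on_LIMSEQ:
  assumes f: "\<And>n. decay_profile_on S (f n)" and lim: "\<And>x. x \<in> S \<Longrightarrow> (\<lambda>n. f n x) \<longlonglongrightarrow> h x"
  shows "decay_profile_on S h"
  unfolding decay_profile_on_def
proof (intro conjI ballI)
  show "convex_on S h" "antimono_on S h" "midpoint_log_concave_on S h"
    by (rule convex_on_LIMSEQ antimono_on_LIMSEQ midpoint_log_concave_on_LIMSEQ;
        fact decay_profile_onD[OF f] lim)+
  fix x assume x: "x \<in> S"
  show "0 \<le> h x" using decay_profile_onD(5)[OF f x] by (intro LIMSEQ_le_const[OF lim[OF x]]) auto
qed

lemma convex_on_powr_mult_diff: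
  fixes k s :: real
  assumes "0 < k" "0 \<le> s"
  shows "convex_on {k..} (\<lambda>y. y powr s * (y - k))"
proof (rule f''_ge0_imp_convex)
  fix y assume "y \<in> {k..}"
  then have y: "0 < y" "k \<le> y" using assms by auto
  have powr: "y powr s = y powr (s - 1) * y" "y powr (s - 1) = y powr (s - 1 - 1) * y"
    using y powr_add[of y "s - 1" 1] powr_add[of y "s - 1 - 1" 1] by simp_all
  show "((\<lambda>y. y powr s * (y - k)) has_real_derivative (s + 1) * y powr s - k * s * y powr (s - 1)) (at y)"
    using y powr(1) by (auto intro!: derivative_eq_intros simp: algebra_simps)
  show "((\<lambda>y. (s + 1) * y powr s - k * s * y powr (s - 1)) has_real_derivative
      (s + 1) * (s * y powr (s - 1)) - k * s * ((s - 1) * y powr (s - 1 - 1))) (at y)"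
    using y by (auto intro!: derivative_eq_intros)
  have "0 \<le> s * y powr (s - 1 - 1) * (s * (y - k) + y + k)"
    using y assms by simp
  also have "\<dots> = (s + 1) * (s * y powr (s - 1)) - k * s * ((s - 1) * y powr (s - 1 - 1))"
    unfolding powr(2) by (simp add: algebra_simps)
  finally show "0 \<le> (s + 1) * (s * y powr (s - 1)) - k * s * ((s - 1) * y powr (s - 1 - 1))" .
qed simp

text \<open>
  For \<open>0 < s < 1\<close> the factor \<open>(B - x) powr s\<close> is concave on its own; the zero at \<open>r < B\<close> compensates.
\<close>

lemma decay_profile_on_endpoint_factor:
  assumes r: "0 < r" "r < B" and s: "0 \<le> s"
  shows "decay_profile_on {0..r} (\<lambda>x. (B - x) powr s * (1 - 1 / r * x))"
proof -
  have linear: "decay_profile_on {0..r} (\<lambda>x. 1 - 1 / r * x)"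
    using r by (intro decay_profile_on_linear) auto
  have "convex_on {0..r} (\<lambda>x. (B - x) powr s * ((B - x) - (B - r)))"
  proof (rule convex_onI)
    fix t x y :: real assume t: "0 < t" "t < 1" and xy: "x \<in> {0..r}" "y \<in> {0..r}"
    have "B - ((1 - t) *\<^sub>R x + t *\<^sub>R y) = (1 - t) *\<^sub>R (B - x) + t *\<^sub>R (B - y)"
      by (simp add: algebra_simps)
    then show "(B - ((1 - t) *\<^sub>R x + t *\<^sub>R y)) powr s * ((B - ((1 - t) *\<^sub>R x + t *\<^sub>R y)) - (B - r))
        \<le> (1 - t) * ((B - x) powr s * ((B - x) - (B - r))) + t * ((B - y) powr s * ((B - y) - (B - r)))"
      using convex_onD[OF convex_on_powr_mult_diff[of "B - r" s], of t "B - x" "B - y"] r s t xy by simp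
  qed simp
  then have "convex_on {0..r} (\<lambda>x. 1 / r * ((B - x) powr s * ((B - x) - (B - r))))"
    using r by (intro convex_on_cmul) auto
  moreover have "1 / r * ((B - x) powr s * ((B - x) - (B - r))) = (B - x) powr s * (1 - 1 / r * x)" for x
    using r by (simp add: field_simps)
  moreover have "antimono_on {0..r} (\<lambda>x. (B - x) powr s)"
    using r s by (auto intro!: monotone_onI powr_mono2)
  moreover have "midpoint_log_concave_on {0..r} (\<lambda>x. (B - x) powr s)"
    using midpoint_log_concave_on_linear[of "{0..r}" B "- 1"] r s
    by (intro midpoint_log_concave_on_powr) auto
  ultimately show ?thesis
    using linear unfolding decay_profile_on_def
    by (auto intro: antimono_on_mult midpoint_log_concave_on_mult)
qed

subsection \<open>Products over reciprocal zeros\<close>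

lemma convergent_prod_linear:
  fixes c :: "nat \<Rightarrow> 'a::{real_normed_field, banach, heine_borel}"
  assumes "summable (\<lambda>j. norm (c j))"
  shows "convergent_prod (\<lambda>j. 1 - c j * u)"
  using summable_mult2[OF assms, of "norm u"]
  by (intro abs_convergent_prod_imp_convergent_prod summable_imp_abs_convergent_prod) (simp add: norm_mult)

text \<open>
  With \<open>c j = 1 / \<zeta> (j + 1)\<close>, padded by zeros, finite, empty and infinite products become one case;
  the weight \<open>h\<close> below stands for \<open>(B - u) powr (b/2)\<close> at a finite endpoint and for \<open>1\<close> otherwise.
\<close>

definition first_zero :: "(nat \<Rightarrow> real) \<Rightarrow> ereal" where
  "first_zero c = (if c 0 = 0 then \<infinity> else ereal (1 / c 0))"

locale reciprocal_zeros =
  fixes c :: "nat \<Rightarrow> real"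
  assumes c_decseq: "decseq c" and c_nonneg: "\<And>j. 0 \<le> c j" and c_summable: "summable c"
begin

lemma factors_convergent: "convergent_prod (\<lambda>j. 1 - c j * u)"
  by (rule convergent_prod_linear) (simp add: c_nonneg c_summable)

lemma tail_factors_convergent: "convergent_prod (\<lambda>j. 1 - c (Suc j) * u)"
  by (rule convergent_prod_linear) (simp add: c_nonneg c_summable summable_Suc_iff)

lemma prodinf_split_first: "(\<Prod>j. 1 - c j * u) = (1 - c 0 * u) * (\<Prod>j. 1 - c (Suc j) * u)"
  using has_prod_unique[OF has_prod_Suc_imp[OF convergent_prod_has_prod[OF tail_factors_convergent]]]
  by (simp add: mult.commute)

lemma le_first_zero_iff: "ereal u \<le> first_zero c \<longleftrightarrow> c 0 * u \<le> 1"
  using c_nonneg[of 0] by (simp add: first_zero_def le_divide_eq mult.commute)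

lemma less_first_zero_iff: "ereal u < first_zero c \<longleftrightarrow> c 0 * u < 1"
  using c_nonneg[of 0] by (simp add: first_zero_def less_divide_eq mult.commute)

lemma first_zero_pos: "0 < first_zero c"
  using less_first_zero_iff[of 0] by (simp add: zero_ereal_def)

lemma convex_initial_segment: "convex (initial_segment (first_zero c))"
proof -
  have "initial_segment (first_zero c) = {u. 0 \<le> u} \<inter> {u. inner (c 0) u \<le> 1}"
    by (auto simp: le_first_zero_iff)
  then show ?thesis using convex_halfspace_le[of "c 0" 1] by (simp add: convex_Int atLeast_def[symmetric])
qed

lemma mult_le_first: "0 \<le> u \<Longrightarrow> c j * u \<le> c 0 * u"
  by (simp add: decseqD[OF c_decseq] mult_right_mono)

lemma decay_profile_on_prodinf_Suc:
  "decay_profile_on (initial_segment (first_zero c)) (\<lambda>u. \<Prod>j. 1 - c (Suc j) * u)"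
proof (rule decay_profile_on_LIMSEQ)
  show "decay_profile_on (initial_segment (first_zero c)) (\<lambda>u. \<Prod>j\<le>n. 1 - c (Suc j) * u)" for n
    by (intro decay_profile_on_prod decay_profile_on_linear convex_initial_segment c_nonneg)
       (use mult_le_first in \<open>auto simp: le_first_zero_iff intro: order_trans\<close>)
  show "(\<lambda>n. \<Prod>j\<le>n. 1 - c (Suc j) * u) \<longlonglongrightarrow> (\<Prod>j. 1 - c (Suc j) * u)" for u
    by (rule convergent_prod_LIMSEQ[OF tail_factors_convergent])
qed

lemma prodinf_Suc_pos:
  assumes "0 \<le> u" "ereal u < first_zero c"
  shows "0 < (\<Prod>j. 1 - c (Suc j) * u)"
proof (rule less_0_prodinf[OF tail_factors_convergent])
  show "0 < 1 - c (Suc j) * u" for j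
    using mult_le_first[of u "Suc j"] assms by (simp add: less_first_zero_iff)
qed

lemma AE_prodinf_nonzero: "AE u in lborel. (\<Prod>j. 1 - c j * u) \<noteq> 0"
proof -
  have "AE u in lborel. u \<notin> range (\<lambda>j. 1 / c j)"
    by (intro AE_not_in countable_imp_null_set_lborel) simp
  then show ?thesis
  proof eventually_elim
    case (elim u)
    have "1 - c j * u \<noteq> 0" for j
    proof
      assume "1 - c j * u = 0"
      then have "u * c j = 1" by (simp add: mult.commute)
      then have "u = 1 / c j" by (cases "c j = 0") (auto simp: field_simps)
      then show False using elim by blast
    qed
    then show ?case by (rule prodinf_nonzero[OF factors_convergent])
  qed
qed

lemma borel_measurable_prodinf [measurable]: "(\<lambda>u. \<Prod>j. 1 - c j * u) \<in> borel_measurable borel"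
proof (rule borel_measurable_LIMSEQ_real)
  show "(\<lambda>n. \<Prod>j\<le>n. 1 - c j * u) \<longlonglongrightarrow> (\<Prod>j. 1 - c j * u)" for u
    by (rule convergent_prod_LIMSEQ[OF factors_convergent])
qed measurable

end

locale weighted_product = reciprocal_zeros +
  fixes a lam C :: real and h \<Phi> :: "real \<Rightarrow> real" and L :: ereal
  assumes a_pos: "0 < a" and lam_nonneg: "0 \<le> lam" and C_pos: "0 < C"
    and nonconstant: "c 0 = 0 \<Longrightarrow> 0 < lam"
    and first_zero_less_L: "\<And>u. ereal u \<le> first_zero c \<Longrightarrow> ereal u < L"
    and h_profile: "decay_profile_on (initial_segment (first_zero c)) (\<lambda>u. h u * (1 - c 0 * u))"
    and h_pos: "\<And>u. ereal u < L \<Longrightarrow> 0 < h u"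
    and h_measurable [measurable]: "h \<in> borel_measurable borel"
    and Phi: "\<And>u. 0 \<le> u \<Longrightarrow> ereal u < L \<Longrightarrow>
      \<Phi> u = C * u powr (a/2) * h u * exp (- lam * u / 2) * (\<Prod>j. 1 - c j * u)"
begin

definition g :: "real \<Rightarrow> real" where
  "g u = C * exp (- (lam / 2) * u) * (h u * (1 - c 0 * u)) * (\<Prod>j. 1 - c (Suc j) * u)"

lemma Phi_eq: "0 \<le> u \<Longrightarrow> ereal u < L \<Longrightarrow> \<Phi> u = u powr (a/2) * g u"
  by (simp add: Phi g_def prodinf_split_first)

lemma g_profile: "decay_profile_on (initial_segment (first_zero c)) g"
  unfolding g_def using C_pos lam_nonneg
  by (intro decay_profile_on_mult decay_profile_on_const decay_profile_on_exp h_profile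
      decay_profile_on_prodinf_Suc convex_initial_segment) auto

lemma g_pos:
  assumes "0 \<le> u" "ereal u < first_zero c"
  shows "0 < g u"
  unfolding g_def using assms C_pos
  by (intro mult_pos_pos prodinf_Suc_pos h_pos first_zero_less_L) (auto simp: less_first_zero_iff le_first_zero_iff)

lemma Phi_tendsto_at_top:
  assumes "first_zero c = \<infinity>"
  shows "(\<Phi> \<longlongrightarrow> 0) at_top"
proof (rule tendsto_sandwich)
  have c_0: "c 0 = 0" and L: "ereal u < L" for u
    using assms first_zero_less_L by (auto simp: first_zero_def split: if_splits)
  have c: "c j = 0" for j using mult_le_first[of 1 j] c_nonneg[of j] c_0 by simp
  have Phi: "\<Phi> u = C * u powr (a/2) * h u * exp (- lam * u / 2)" if "0 \<le> u" for u
    using Phi[OF that L] by (simp add: c)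
  have h_bounds: "0 \<le> h u" "h u \<le> h 0" if "0 \<le> u" for u
    using decay_profile_on_antimonoD[OF h_profile, of 0 u] h_pos[OF L] that
    by (auto simp: c_0 le_first_zero_iff intro: less_imp_le)
  show "\<forall>\<^sub>F u in at_top. 0 \<le> \<Phi> u"
    using eventually_ge_at_top[of 0] by eventually_elim (use Phi h_bounds C_pos in simp)
  show "\<forall>\<^sub>F u in at_top. \<Phi> u \<le> C * u powr (a/2) * h 0 * exp (- lam * u / 2)"
    using eventually_ge_at_top[of 0]
    by eventually_elim (use Phi h_bounds C_pos in \<open>auto intro!: mult_right_mono mult_left_mono\<close>)
  have "0 < h 0" "0 < lam" using h_pos L nonconstant c_0 by auto
  then show "((\<lambda>u. C * u powr (a/2) * h 0 * exp (- lam * u / 2)) \<longlongrightarrow> 0) at_top"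
    using a_pos C_pos by real_asymp
qed simp

sublocale profile: extended_power_profile a "first_zero c" g \<Phi> L
proof
  show "0 < a" "0 < first_zero c" "decay_profile_on (initial_segment (first_zero c)) g"
    by (fact a_pos first_zero_pos g_profile)+
  show "0 < g u" if "0 \<le> u" "ereal u < first_zero c" for u using that by (rule g_pos)
  show "g r = 0" if "first_zero c = ereal r" for r
    using that by (auto simp: first_zero_def g_def split: if_splits)
  show "(\<Phi> \<longlongrightarrow> 0) at_top" if "first_zero c = \<infinity>" using that by (rule Phi_tendsto_at_top)
  show "\<Phi> u = u powr (a/2) * g u" if "0 \<le> u" "ereal u \<le> first_zero c" for u
    using that by (intro Phi_eq first_zero_less_L)
  show "ereal u < L" if "ereal u \<le> first_zero c" for u using that by (rule first_zero_less_L)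
  have "(\<lambda>u. indicator (einterval 0 L) u *\<^sub>R \<Phi> u) = (\<lambda>u. indicator (einterval 0 L) u *
      (C * u powr (a/2) * h u * exp (- lam * u / 2) * (\<Prod>j. 1 - c j * u)))"
    using Phi by (auto simp: fun_eq_iff indicator_def einterval_iff)
  then show "set_borel_measurable borel (einterval 0 L) \<Phi>"
    unfolding set_borel_measurable_def by simp
  show "AE u in lborel. u \<in> einterval 0 L \<longrightarrow> \<Phi> u \<noteq> 0"
    using AE_prodinf_nonzero
  proof eventually_elim
    case (elim u)
    then show ?case using Phi[of u] C_pos h_pos[of u] by (auto simp: einterval_iff)
  qed
qed

end

subsection \<open>The two endpoint cases\<close>

definition finite_reciprocals :: "nat \<Rightarrow> (nat \<Rightarrow> real) \<Rightarrow> nat \<Rightarrow> real" where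
  "finite_reciprocals N \<zeta> j = (if j < N then 1 / \<zeta> (Suc j) else 0)"

lemma reciprocal_zeros_finite_reciprocals:
  assumes mono: "strict_mono_on {1..N} \<zeta>" and pos: "\<forall>j\<in>{1..N}. 0 < \<zeta> j"
  shows "reciprocal_zeros (finite_reciprocals N \<zeta>)"
proof
  have \<zeta>_pos: "0 < \<zeta> (Suc j)" if "j < N" for j using pos that by simp
  show nonneg: "0 \<le> finite_reciprocals N \<zeta> j" for j
    using \<zeta>_pos[of j] by (simp add: finite_reciprocals_def less_imp_le)
  show "decseq (finite_reciprocals N \<zeta>)"
  proof (rule decseq_SucI)
    fix j
    show "finite_reciprocals N \<zeta> (Suc j) \<le> finite_reciprocals N \<zeta> j"
    proof (cases "Suc j < N")
      case True
      then have "\<zeta> (Suc j) \<le> \<zeta> (Suc (Suc j))"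
        by (intro strict_mono_on_leD[OF mono]) auto
      then show ?thesis using True \<zeta>_pos[of j] by (simp add: finite_reciprocals_def frac_le)
    next
      case False
      then have "finite_reciprocals N \<zeta> (Suc j) = 0" by (simp add: finite_reciprocals_def)
      then show ?thesis using nonneg by simp
    qed
  qed
  show "summable (finite_reciprocals N \<zeta>)"
    by (rule summable_finite[of "{..<N}"]) (auto simp: finite_reciprocals_def)
qed

lemma prodinf_finite_reciprocals:
  "(\<Prod>j. 1 - finite_reciprocals N \<zeta> j * u) = (\<Prod>j=1..N. 1 - u / \<zeta> j)"
proof -
  have "(\<Prod>j. 1 - finite_reciprocals N \<zeta> j * u) = (\<Prod>j<N. 1 - finite_reciprocals N \<zeta> j * u)"
    by (rule prodinf_finite) (auto simp: finite_reciprocals_def)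
  also have "\<dots> = (\<Prod>j<N. 1 - u / \<zeta> (Suc j))"
    by (rule prod.cong) (auto simp: finite_reciprocals_def)
  also have "\<dots> = (\<Prod>j=1..N. 1 - u / \<zeta> j)"
    by (rule prod.reindex_bij_witness[of _ "\<lambda>j. j - 1" Suc]) auto
  finally show ?thesis .
qed

lemma first_zero_finite_reciprocals:
  assumes "\<forall>j\<in>{1..N}. 0 < \<zeta> j"
  shows "first_zero (finite_reciprocals N \<zeta>) = (if N = 0 then \<infinity> else ereal (\<zeta> 1))"
proof (cases "N = 0")
  case False
  then have "0 < \<zeta> 1" using assms by simp
  then show ?thesis using False by (simp add: first_zero_def finite_reciprocals_def)
qed (simp add: first_zero_def finite_reciprocals_def)

lemma reciprocal_zeros_reciprocals:
  assumes mono: "strict_mono_on {1..} \<zeta>" and pos: "\<forall>j\<ge>1. 0 < \<zeta> j"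
    and sum: "summable (\<lambda>j. 1 / \<zeta> (Suc j))"
  shows "reciprocal_zeros (\<lambda>j. 1 / \<zeta> (Suc j))"
proof
  show "decseq (\<lambda>j. 1 / \<zeta> (Suc j))"
  proof (rule decseq_SucI)
    fix j
    have "\<zeta> (Suc j) \<le> \<zeta> (Suc (Suc j))" by (rule strict_mono_on_leD[OF mono]) auto
    then show "1 / \<zeta> (Suc (Suc j)) \<le> 1 / \<zeta> (Suc j)" using pos by (simp add: frac_le)
  qed
  show "0 \<le> 1 / \<zeta> (Suc j)" for j using pos by (simp add: less_imp_le)
qed (rule sum)

lemma finite_endpoint_imp_weighted_product:
  assumes "0 < a" "0 \<le> lam" "0 < C" "\<Phi> 0 = 0" and endpoint: "finite_endpoint a lam C \<Phi> z L"
  shows "\<exists>c h. weighted_product c a lam C h \<Phi> L \<and> z = first_zero c"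
proof -
  obtain B b and N :: nat and \<zeta> :: "nat \<Rightarrow> real" where N: "1 \<le> N" and b: "0 \<le> b"
    and mono: "strict_mono_on {1..N} \<zeta>" and \<zeta>: "\<forall>j\<in>{1..N}. 0 < \<zeta> j" "\<forall>j\<in>{1..N}. \<zeta> j < B"
    and Phi: "\<And>u. 0 < u \<Longrightarrow> u < B \<Longrightarrow> \<Phi> u = C * u powr (a/2) * (B - u) powr (b/2) * exp (- lam * u / 2)
               * (\<Prod>j=1..N. 1 - u / \<zeta> j)"
    and z: "z = ereal (\<zeta> 1)" and L: "L = ereal B"
    using endpoint unfolding finite_endpoint_def by blast
  define c where "c = finite_reciprocals N \<zeta>"
  have \<zeta>_1: "0 < \<zeta> 1" "\<zeta> 1 < B" using \<zeta> N by auto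
  have c_0: "c 0 = 1 / \<zeta> 1" using N by (simp add: c_def finite_reciprocals_def)
  have first_zero: "first_zero c = ereal (\<zeta> 1)"
    using first_zero_finite_reciprocals[OF \<zeta>(1)] N by (simp add: c_def)
  interpret reciprocal_zeros c
    unfolding c_def by (rule reciprocal_zeros_finite_reciprocals[OF mono \<zeta>(1)])
  have "weighted_product c a lam C (\<lambda>u. (B - u) powr (b/2)) \<Phi> L"
  proof
    show "ereal u < L" if "ereal u \<le> first_zero c" for u
      using that \<zeta>_1 by (simp add: first_zero L)
    have "initial_segment (first_zero c) = {0..\<zeta> 1}" by (auto simp: first_zero)
    then show "decay_profile_on (initial_segment (first_zero c)) (\<lambda>u. (B - u) powr (b/2) * (1 - c 0 * u))"
      using decay_profile_on_endpoint_factor[OF \<zeta>_1, of "b/2"] b by (simp add: c_0)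
    show "\<Phi> u = C * u powr (a/2) * (B - u) powr (b/2) * exp (- lam * u / 2) * (\<Prod>j. 1 - c j * u)"
      if "0 \<le> u" "ereal u < L" for u
      using Phi[of u] that assms(1,4) L
      by (cases "u = 0") (simp_all add: c_def prodinf_finite_reciprocals)
  qed (use assms \<zeta>_1 in \<open>simp_all add: c_0 L\<close>)
  then show ?thesis using first_zero z by auto
qed

lemma (in reciprocal_zeros) weighted_product_infinite_endpoint:
  assumes "0 < a" "0 \<le> lam" "0 < C" "\<Phi> 0 = 0" "c 0 = 0 \<Longrightarrow> 0 < lam"
    and Phi: "\<And>u. 0 < u \<Longrightarrow> \<Phi> u = C * u powr (a/2) * exp (- lam * u / 2) * (\<Prod>j. 1 - c j * u)"
  shows "weighted_product c a lam C (\<lambda>_. 1) \<Phi> \<infinity>"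
proof
  show "decay_profile_on (initial_segment (first_zero c)) (\<lambda>u. 1 * (1 - c 0 * u))"
    using decay_profile_on_linear[OF convex_initial_segment c_nonneg] by (simp add: le_first_zero_iff)
  show "\<Phi> u = C * u powr (a/2) * 1 * exp (- lam * u / 2) * (\<Prod>j. 1 - c j * u)" if "0 \<le> u" for u
    using Phi[of u] that assms(1,4) by (cases "u = 0") simp_all
qed (use assms in auto)

lemma infinite_endpoint_imp_weighted_product:
  assumes "0 < a" "0 \<le> lam" "0 < C" "\<Phi> 0 = 0" and endpoint: "infinite_endpoint a lam C \<Phi> z L"
  shows "\<exists>c h. weighted_product c a lam C h \<Phi> L \<and> z = first_zero c"
proof -
  have L: "L = \<infinity>" using endpoint by (simp add: infinite_endpoint_def)
  have "\<exists>c. reciprocal_zeros c \<and> z = first_zero c \<and> (c 0 = 0 \<longrightarrow> 0 < lam) \<and>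
      (\<forall>u>0. \<Phi> u = C * u powr (a/2) * exp (- lam * u / 2) * (\<Prod>j. 1 - c j * u))"
    using endpoint unfolding infinite_endpoint_def
  proof (elim conjE disjE exE)
    fix N :: nat and \<zeta> :: "nat \<Rightarrow> real"
    assume lam: "N = 0 \<longrightarrow> 0 < lam" and mono: "strict_mono_on {1..N} \<zeta>"
      and pos: "\<forall>j\<in>{1..N}. 0 < \<zeta> j"
      and Phi: "\<forall>u>0. \<Phi> u = C * u powr (a/2) * exp (- lam * u / 2) * (\<Prod>j=1..N. 1 - u / \<zeta> j)"
      and z: "z = (if N = 0 then \<infinity> else ereal (\<zeta> 1))"
    have "finite_reciprocals N \<zeta> 0 = 0 \<longrightarrow> 0 < lam"
      using lam bspec[OF pos, of 1] by (auto simp: finite_reciprocals_def)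
    then show ?thesis
      using reciprocal_zeros_finite_reciprocals[OF mono pos] first_zero_finite_reciprocals[OF pos] z Phi
      by (intro exI[of _ "finite_reciprocals N \<zeta>"]) (simp add: prodinf_finite_reciprocals)
  next
    fix \<zeta> :: "nat \<Rightarrow> real"
    assume mono: "strict_mono_on {1..} \<zeta>" and pos: "\<forall>j\<ge>1. 0 < \<zeta> j"
      and sum: "summable (\<lambda>j. 1 / \<zeta> (Suc j))"
      and Phi: "\<forall>u>0. \<Phi> u = C * u powr (a/2) * exp (- lam * u / 2) * (\<Prod>j. 1 - u / \<zeta> (Suc j))"
      and z: "z = ereal (\<zeta> 1)"
    have "0 < \<zeta> 1" using pos by simp
    then show ?thesis
      using reciprocal_zeros_reciprocals[OF mono pos sum] z Phi
      by (intro exI[of _ "\<lambda>j. 1 / \<zeta> (Suc j)"]) (simp add: first_zero_def)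
  qed
  then obtain c where "reciprocal_zeros c" "z = first_zero c" "c 0 = 0 \<longrightarrow> 0 < lam"
    and "\<forall>u>0. \<Phi> u = C * u powr (a/2) * exp (- lam * u / 2) * (\<Prod>j. 1 - c j * u)"
    by blast
  then have "weighted_product c a lam C (\<lambda>_. 1) \<Phi> L"
    unfolding L using assms(1-4) by (intro reciprocal_zeros.weighted_product_infinite_endpoint) auto
  then show ?thesis using \<open>z = first_zero c\<close> by blast
qed

theorem theorem5p2:
  fixes a lam C :: real and \<Phi> :: "real \<Rightarrow> real" and z L :: ereal
  assumes "a > 0" and "lam \<ge> 0" and "C > 0"
    and "finite_endpoint a lam C \<Phi> z L \<or> infinite_endpoint a lam C \<Phi> z L"
    and "\<Phi> 0 = 0"
  shows "(\<Phi> \<longlongrightarrow> 0) (at_right 0)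
    \<and> (\<exists>!u1. is_arg_max \<Phi> (\<lambda>u. u \<in> einterval 0 z) u1)
    \<and> (\<forall>u1 A. is_arg_max \<Phi> (\<lambda>u. u \<in> einterval 0 z) u1 \<and> A = \<Phi> u1 \<longrightarrow>
          (\<forall>t. 0 \<le> t \<and> t \<le> 1 + 2/a \<longrightarrow>
             \<Phi> (t * u1) / A \<ge> t powr (a/2) * (1 + a/2 * (1 - t)))
        \<and> (LBINT u=0..ereal u1. (\<Phi> u)\<^sup>2 / u) \<ge> A\<^sup>2 / a * R a
        \<and> (inverse_moment \<Phi> L < \<infinity> \<longrightarrow>
             A\<^sup>2 < a * enn2real (inverse_moment \<Phi> L) / R_star a))
    \<and> R a = (5 * a\<^sup>2 + 10 * a + 4) / (2 * (a + 1) * (a + 2))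
    \<and> R_star a = (a + 2) / (2 * (a + 1)) * ((a + 2) / a) powr a
    \<and> R_star a > R a"
proof -
  obtain c h where "weighted_product c a lam C h \<Phi> L" and z: "z = first_zero c"
    using finite_endpoint_imp_weighted_product infinite_endpoint_imp_weighted_product assms by metis
  then interpret weighted_product c a lam C h \<Phi> L by simp
  have "\<exists>!w. profile.maximizer w"
    using profile.maximizer_exists profile.maximizer_unique by blast
  then show ?thesis
    using profile.Phi_tendsto_0 profile.Phi_ratio_ge_minorant[unfolded minorant_def]
      profile.integral_lower_bound profile.maximum_square_less_inverse_moment
      R_eq[OF \<open>a > 0\<close>] R_star_eq[OF \<open>a > 0\<close>] R_less_R_star[OF \<open>a > 0\<close>]
    unfolding z by blast
qed

end
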